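(* There exists a separable, Moore paratopological group $G$ such that $G$ is not metrizable.
   Context: All spaces are $T_0$. A paratopological group is a group $G$ with a topology such that the product map $G\times G\to G$ is jointly continuous. A sequence $\{\mathscr{P}_n\}_n$ of collections of open subsets of a space $X$ is a development for $X$ if for each $x\in X$ the family $\{\mathrm{st}(x,\mathscr{P}_n)\}_n$ is a neighborhood base at $x$, where $\mathrm{st}(x,\mathscr{P}_n)=\bigcup\{P\in\mathscr{P}_n: x\in P\}$. $X$ is developable if it has a development, and Moore if it is regular and developable. *)

theory Defs
  imports "HOL-Analysis.Analysis" "HOL-Algebra.Group"
begin

(* Existence over groups with carrier in the type real covers all separable
   T0 Moore groups: such a space is Hausdorff and first countable, hence has
   at most continuum many points. *)
definition paratopological_group :: "('a, 'b) monoid_scheme \<Rightarrow> 'a topology \<Rightarrow> bool" where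
  "paratopological_group G T \<longleftrightarrow>
     group G \<and> topspace T = carrier G \<and>
     continuous_map (prod_topology T T) T (\<lambda>(x, y). x \<otimes>\<^bsub>G\<^esub> y)"

definition star :: "'a \<Rightarrow> 'a set set \<Rightarrow> 'a set" where
  "star x \<P> = \<Union>{P \<in> \<P>. x \<in> P}"

(* The library's neighbourhood_base_at does not require the members of the
   family to be neighbourhoods of the point; here this is required. *)
definition nbhd_base_family :: "'a topology \<Rightarrow> 'a \<Rightarrow> 'a set set \<Rightarrow> bool" where
  "nbhd_base_family X x \<N> \<longleftrightarrow>
     (\<forall>N \<in> \<N>. N \<subseteq> topspace X \<and> (\<exists>U. openin X U \<and> x \<in> U \<and> U \<subseteq> N)) \<and>
     (\<forall>W. openin X W \<and> x \<in> W \<longrightarrow> (\<exists>N \<in> \<N>. N \<subseteq> W))"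

definition development :: "'a topology \<Rightarrow> (nat \<Rightarrow> 'a set set) \<Rightarrow> bool" where
  "development X \<P> \<longleftrightarrow>
     (\<forall>n. \<forall>P \<in> \<P> n. openin X P) \<and>
     (\<forall>x \<in> topspace X. nbhd_base_family X x (range (\<lambda>n. star x (\<P> n))))"

definition developable_space :: "'a topology \<Rightarrow> bool" where
  "developable_space X \<longleftrightarrow> (\<exists>\<P>. development X \<P>)"

definition Moore_space :: "'a topology \<Rightarrow> bool" where
  "Moore_space X \<longleftrightarrow> regular_space X \<and> developable_space X"

end

theory Submission
  imports Defs
begin

text \<open>
  The group is the subgroup of the Sorgenfrey plane of all points whose coordinate sum is rational.
  Turned by 45 degrees it becomes the set of pairs (p, q) with p real and q rational, where the basic
  neighbourhoods of a point are truncated closed upward cones with that point as apex. Every level set of q is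
  discrete, and one of them being uncountable, the space is not second countable. There are only
  countably many levels: if the cones of the n-th cover avoid the first n levels except possibly
  at their apex, then a point on one of those levels lies in no cone but those with apex at it,
  and this gives a development.
\<close>

text \<open>The balls of radius \<open>1/(n+1)\<close> about the points of a countable dense set
  form a countable base. Non-metrizability will follow from the lack of such a base.\<close>

lemma separable_metrizable_imp_second_countable:
  assumes "metrizable_space X" and "separable_space X"
  shows "second_countable X"
proof -
  obtain M d where "Metric_space M d" and X: "X = Metric_space.mtopology M d"
    using assms(1) unfolding metrizable_space_def by blast
  interpret Metric_space M d by fact
  obtain D where D: "countable D" "D \<subseteq> M" and dense: "mtopology closure_of D = M"
    using assms(2) by (auto simp: separable_space_def X)
  define \<B> where "\<B> = (\<lambda>(x, n). mball x (inverse (real (Suc n)))) ` (D \<times> (UNIV :: nat set))"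
  show ?thesis
    unfolding second_countable_def
  proof (intro exI[of _ \<B>] conjI allI impI)
    show "countable \<B>"
      using D by (simp add: \<B>_def)
    show "\<forall>V\<in>\<B>. openin X V"
      by (auto simp: \<B>_def X)
  next
    fix U x
    assume "openin X U \<and> x \<in> U"
    then obtain r where r: "r > 0" "mball x r \<subseteq> U" and x: "x \<in> M"
      by (metis X openin_mtopology subsetD)
    obtain n where n: "inverse (real (Suc n)) < r / 2"
      using r by (metis half_gt_zero reals_Archimedean)
    have "x \<in> mtopology closure_of D"
      using x dense by simp
    then have "\<forall>r>0. \<exists>a\<in>D. a \<in> mball x r"
      by (simp add: metric_closure_of)
    moreover have "0 < inverse (real (Suc n))"
      by simp
    ultimately obtain a where a: "a \<in> D" "a \<in> mball x (inverse (real (Suc n)))"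
      by blast
    let ?V = "mball a (inverse (real (Suc n)))"
    have "?V \<in> \<B>"
      using a(1) by (auto simp: \<B>_def)
    moreover have "x \<in> ?V"
      using a by (simp only: in_mball commute)
    moreover have "?V \<subseteq> mball x r"
    proof
      fix z
      assume z: "z \<in> ?V"
      then have "d x z \<le> d x a + d a z"
        using x a by (intro triangle) (simp_all only: in_mball)
      also have "\<dots> < r / 2 + r / 2"
        using z a n by (intro add_strict_mono) (simp_all only: in_mball, linarith+)
      finally show "z \<in> mball x r"
        using z x by (simp add: in_mball)
    qed
    ultimately show "\<exists>V\<in>\<B>. x \<in> V \<and> V \<subseteq> U"
      using r by blast
  qed
qed

text \<open>The group must live on the type \<open>real\<close>, so points of the plane are coded by
  reals. The cardinality is squeezed between those of the line and of the full plane, which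
  agree.\<close>

lemma real_bij_betw_real_times_rat: "\<exists>h :: real \<Rightarrow> real \<times> real. bij_betw h UNIV (UNIV \<times> \<rat>)"
proof -
  have "(UNIV :: real set) \<times> (\<rat> :: real set) \<lesssim> (UNIV :: real set) \<times> (UNIV :: real set)"
    by (intro times_lepoll_mono subset_imp_lepoll) auto
  also have "\<dots> \<approx> (UNIV :: real set)"
    unfolding eqpoll_iff_card_of_ordIso
    using card_of_Times_same_infinite infinite_UNIV_char_0 by blast
  finally have "(UNIV :: real set) \<times> (\<rat> :: real set) \<lesssim> (UNIV :: real set)" .
  moreover have "(UNIV :: real set) \<lesssim> (UNIV :: real set) \<times> (\<rat> :: real set)"
    by (rule lepoll_times1) (use Rats_0 in blast)
  ultimately show ?thesis
    using lepoll_antisym eqpoll_def by metis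
qed

section \<open>Coordinates and the topology of truncated cones\<close>

locale rational_plane =
  fixes p q :: "'a \<Rightarrow> real"
  assumes bij: "bij_betw (\<lambda>x. (p x, q x)) UNIV (UNIV \<times> \<rat>)"
begin

lemma eqI: "p x = p y \<Longrightarrow> q x = q y \<Longrightarrow> x = y"
  using bij by (auto simp: bij_betw_def inj_def)

lemma q_Rats [simp]: "q x \<in> \<rat>"
  using bij by (auto simp: bij_betw_def)

lemma point_exists: "b \<in> \<rat> \<Longrightarrow> \<exists>x. p x = a \<and> q x = b"
proof -
  assume "b \<in> \<rat>"
  then have "(a, b) \<in> range (\<lambda>x. (p x, q x))"
    using bij by (simp add: bij_betw_def)
  then show ?thesis
    by auto
qed

text \<open>The first inequality says that neither \<open>q + p\<close> nor \<open>q - p\<close>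
  decreases from \<open>y\<close> to \<open>z\<close>: in these Sorgenfrey coordinates the cone is a
  closed quadrant, cut off below height \<open>e\<close>.\<close>

definition cone :: "'a \<Rightarrow> real \<Rightarrow> 'a set" where
  "cone y e = {z. \<bar>p z - p y\<bar> \<le> q z - q y \<and> q z - q y < e}"

definition T :: "'a topology" where
  "T = topology (\<lambda>W. \<forall>y\<in>W. \<exists>e>0. cone y e \<subseteq> W)"

lemma apex_in_cone: "0 < e \<Longrightarrow> y \<in> cone y e"
  by (simp add: cone_def)

lemma cone_mono: "e \<le> e' \<Longrightarrow> cone y e \<subseteq> cone y e'"
  by (auto simp: cone_def)

text \<open>At height zero the cone has width zero. This is what makes every level discrete.\<close>

lemma cone_level: "z \<in> cone y e \<Longrightarrow> q z = q y \<Longrightarrow> z = y"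
  by (rule eqI) (auto simp: cone_def)

lemma openin_T: "openin T W \<longleftrightarrow> (\<forall>y\<in>W. \<exists>e>0. cone y e \<subseteq> W)"
proof -
  have "istopology (\<lambda>W. \<forall>y\<in>W. \<exists>e>0. cone y e \<subseteq> W)"
    unfolding istopology_def
  proof (intro conjI allI impI ballI)
    fix S W y
    assume S: "\<forall>y\<in>S. \<exists>e>0. cone y e \<subseteq> S" and W: "\<forall>y\<in>W. \<exists>e>0. cone y e \<subseteq> W" and "y \<in> S \<inter> W"
    then obtain e e' where "e > 0" "cone y e \<subseteq> S" "e' > 0" "cone y e' \<subseteq> W"
      by blast
    then show "\<exists>e>0. cone y e \<subseteq> S \<inter> W"
      by (intro exI[of _ "min e e'"])
        (use cone_mono[of "min e e'" e y] cone_mono[of "min e e'" e' y] in auto)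
  next
    fix \<K> y
    assume *: "\<forall>K\<in>\<K>. \<forall>y\<in>K. \<exists>e>0. cone y e \<subseteq> K" and "y \<in> \<Union>\<K>"
    then obtain K where "K \<in> \<K>" "y \<in> K" by blast
    with * obtain e where "e > 0" "cone y e \<subseteq> K" by blast
    with \<open>K \<in> \<K>\<close> show "\<exists>e>0. cone y e \<subseteq> \<Union>\<K>" by blast
  qed
  then show ?thesis
    by (simp add: T_def topology_inverse')
qed

lemma topspace_T [simp]: "topspace T = UNIV"
proof -
  have "openin T UNIV"
    unfolding openin_T using zero_less_one by blast
  then show ?thesis
    using openin_subset by blast
qed

lemma openin_cone: "openin T (cone y e)"
  unfolding openin_T
proof
  fix z
  assume z: "z \<in> cone y e"
  \<comment> \<open>By the triangle inequality the cone conditions add up; only the height left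
    above \<open>z\<close> limits the smaller cone.\<close>
  have "cone z (e - (q z - q y)) \<subseteq> cone y e"
    using z by (auto simp: cone_def)
  then show "\<exists>r>0. cone z r \<subseteq> cone y e"
    using z by (intro exI[of _ "e - (q z - q y)"]) (simp add: cone_def)
qed

lemma closedin_cone: "closedin T {z. \<bar>p z - p y\<bar> \<le> q z - q y \<and> q z - q y \<le> e}" (is "closedin T ?C")
proof -
  have "openin T (- ?C)"
    unfolding openin_T
  proof
    fix z
    assume "z \<in> - ?C"
    then consider "q z - q y > e" | "\<bar>p z - p y\<bar> > q z - q y"
      by fastforce
    then show "\<exists>r>0. cone z r \<subseteq> - ?C"
    proof cases
      case 1
      then have "cone z 1 \<subseteq> - ?C"
        by (auto simp: cone_def)
      then show ?thesis
        using zero_less_one by blast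
    next
      case 2
      \<comment> \<open>Inside \<open>cone z r\<close> the distance to \<open>p y\<close> drops by
        less than \<open>r\<close> and the height over \<open>y\<close> grows by less than
        \<open>r\<close>, so a gap of \<open>2 * r\<close> stays positive.\<close>
      define r where "r = (\<bar>p z - p y\<bar> - (q z - q y)) / 2"
      have "r > 0"
        using 2 by (simp add: r_def)
      moreover have "cone z r \<subseteq> - ?C"
        by (auto simp: cone_def r_def)
      ultimately show ?thesis
        by blast
    qed
  qed
  then show ?thesis
    by (simp add: closedin_def Compl_eq_Diff_UNIV)
qed

lemma regular_T: "regular_space T"
  unfolding neighbourhood_base_of_closedin [symmetric] neighbourhood_base_of
proof (intro allI impI)
  fix W y
  assume "openin T W \<and> y \<in> W"
  then obtain e where e: "e > 0" "cone y e \<subseteq> W"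
    by (auto simp: openin_T)
  let ?C = "{z. \<bar>p z - p y\<bar> \<le> q z - q y \<and> q z - q y \<le> e / 2}"
  \<comment> \<open>A closed cone fits between two open ones, which gives a base of closed
    neighbourhoods.\<close>
  have "cone y (e / 2) \<subseteq> ?C" "?C \<subseteq> cone y e"
    using e by (auto simp: cone_def)
  then show "\<exists>U V. openin T U \<and> closedin T V \<and> y \<in> U \<and> U \<subseteq> V \<and> V \<subseteq> W"
    using openin_cone closedin_cone e apex_in_cone half_gt_zero by (meson order_trans)
qed

lemma t0_T: "t0_space T"
  unfolding t0_space_def
proof (intro ballI impI)
  fix x y :: 'a
  assume "x \<noteq> y"
  \<comment> \<open>If each point lay in the cone of the other, both would be on one level and hence
    equal.\<close>
  have "y \<notin> cone x 1 \<or> x \<notin> cone y 1"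
    using cone_level[of y x 1] \<open>x \<noteq> y\<close> by (force simp: cone_def)
  then show "\<exists>U. openin T U \<and> (x \<notin> U \<longleftrightarrow> y \<in> U)"
    using openin_cone apex_in_cone zero_less_one by metis
qed

section \<open>Separability and failure of metrizability\<close>

lemma separable_T: "separable_space T"
  unfolding separable_space_def
proof (intro exI conjI)
  let ?D = "{x. p x \<in> \<rat>}"
  have "inj_on (\<lambda>x. (p x, q x)) ?D"
    using eqI by (auto simp: inj_on_def)
  moreover have "(\<lambda>x. (p x, q x)) ` ?D \<subseteq> \<rat> \<times> \<rat>"
    by auto
  ultimately show "countable ?D"
    using countable_rat by (meson countable_SIGMA countable_image_inj_on countable_subset)
  show "T closure_of ?D = topspace T"
    unfolding dense_intersects_open
  proof (intro allI impI)
    fix W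
    assume "openin T W \<and> W \<noteq> {}"
    then obtain y e where "e > 0" "cone y e \<subseteq> W"
      unfolding openin_T by blast
    \<comment> \<open>Going up by a rational \<open>b\<close> first makes the cone wide enough at
      that height to contain a point with rational \<open>p\<close>.\<close>
    obtain b where b: "b \<in> \<rat>" "0 < b" "b < e"
      using Rats_dense_in_real \<open>e > 0\<close> by blast
    obtain a where a: "a \<in> \<rat>" "p y < a" "a < p y + b"
      using Rats_dense_in_real[of "p y" "p y + b"] b by auto
    obtain z where "p z = a" "q z = q y + b"
      using point_exists[of "q y + b" a] b by auto
    then have "z \<in> cone y e" "z \<in> ?D"
      using a b by (auto simp: cone_def)
    then show "?D \<inter> W \<noteq> {}"
      using \<open>cone y e \<subseteq> W\<close> by blast
  qed
qed simp

lemma not_second_countable_T: "\<not> second_countable T"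
proof
  assume "second_countable T"
  then obtain \<B> where \<B>: "countable \<B>"
    and base: "\<And>U x. openin T U \<Longrightarrow> x \<in> U \<Longrightarrow> \<exists>V\<in>\<B>. x \<in> V \<and> V \<subseteq> U"
    unfolding second_countable_def by metis
  have "\<forall>x. \<exists>V. V \<in> \<B> \<and> x \<in> V \<and> V \<subseteq> cone x 1"
    using base openin_cone apex_in_cone zero_less_one by meson
  then obtain V where V: "\<And>x. V x \<in> \<B>" "\<And>x. x \<in> V x" "\<And>x. V x \<subseteq> cone x 1"
    by metis
  let ?Z = "{x. q x = 0}"
  \<comment> \<open>Each \<open>V x\<close> meets the level \<open>q = 0\<close> in \<open>x\<close>
    alone, so an uncountable level needs uncountably many base sets.\<close>
  have "inj_on V ?Z"
  proof (rule inj_onI)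
    fix x y
    assume *: "x \<in> ?Z" "y \<in> ?Z" "V x = V y"
    then have "x \<in> cone y 1"
      using V by blast
    then show "x = y"
      using * cone_level by simp
  qed
  moreover have "countable (V ` ?Z)"
    using \<B> by (rule countable_subset[rotated]) (use V in blast)
  ultimately have "countable ?Z"
    using countable_image_inj_on by blast
  then have "countable (p ` ?Z)"
    by simp
  moreover have "p ` ?Z = UNIV"
  proof (rule equalityI[OF subset_UNIV subsetI])
    show "a \<in> p ` ?Z" for a
      using point_exists[OF Rats_0, of a] by auto
  qed
  ultimately show False
    using uncountable_UNIV_real by metis
qed

lemma not_metrizable_T: "\<not> metrizable_space T"
  using separable_metrizable_imp_second_countable[OF _ separable_T] not_second_countable_T by metis

section \<open>Developability\<close>

lemma developable_T: "developable_space T"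
proof -
  \<comment> \<open>These finite sets of levels increase with \<open>n\<close> and exhaust the
    rationals.\<close>
  define F where "F n = {r \<in> \<rat> :: real set. to_nat_on (\<rat> :: real set) r \<le> n}" for n
  have finite_F: "finite (F n)" for n
  proof (rule finite_imageD)
    show "finite (to_nat_on (\<rat> :: real set) ` F n)"
      by (rule finite_subset[of _ "{..n}"]) (auto simp: F_def)
    show "inj_on (to_nat_on (\<rat> :: real set)) (F n)"
      using inj_on_to_nat_on[OF countable_rat] by (rule inj_on_subset) (auto simp: F_def)
  qed
  \<comment> \<open>A cone has its heights in the interval from \<open>q y\<close> up to, but
    excluding, \<open>q y + e\<close>. The last condition keeps the levels in \<open>F n\<close> out
    of it, except that of the apex, which must be allowed for the cones to cover.\<close>
  define \<P> where "\<P> n = {cone y e |y e. 0 < e \<and> e < inverse (real (Suc n)) \<and>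
      (\<forall>r\<in>F n. r \<le> q y \<or> q y + e \<le> r)}" for n
  have star_nbhd: "\<exists>U. openin T U \<and> x \<in> U \<and> U \<subseteq> star x (\<P> n)" for x n
  proof -
    \<comment> \<open>Finiteness of \<open>F n\<close> leaves a gap above the level of
      \<open>x\<close>, into which a short cone at \<open>x\<close> fits.\<close>
    obtain d where d: "d > 0" "\<forall>r\<in>F n. r \<noteq> q x \<longrightarrow> d \<le> dist (q x) r"
      using finite_set_avoid[OF finite_F] by blast
    define e where "e = min d (inverse (real (Suc n)) / 2)"
    have e: "0 < e" "e < inverse (real (Suc n))" "e \<le> d"
      using d by (auto simp: e_def min_def)
    have "\<forall>r\<in>F n. r \<le> q x \<or> q x + e \<le> r"
      using d(2) e by (force simp: dist_real_def)
    then have "cone x e \<in> \<P> n"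
      using e by (auto simp: \<P>_def)
    then show ?thesis
      using apex_in_cone[OF e(1)] by (intro exI[of _ "cone x e"]) (auto simp: openin_cone star_def)
  qed
  have star_small: "\<exists>n. star x (\<P> n) \<subseteq> W" if "openin T W" "x \<in> W" for x W
  proof -
    obtain e where e: "e > 0" "cone x e \<subseteq> W"
      using \<open>openin T W\<close> \<open>x \<in> W\<close> unfolding openin_T by blast
    obtain m where m: "inverse (real (Suc m)) < e"
      using e reals_Archimedean by blast
    \<comment> \<open>Large enough for two purposes: cones in the cover are shorter than
      \<open>e\<close>, and the level of \<open>x\<close> already belongs to
      \<open>F n\<close>.\<close>
    define n where "n = max m (to_nat_on (\<rat> :: real set) (q x))"
    have "inverse (real (Suc n)) \<le> inverse (real (Suc m))"
      by (rule le_imp_inverse_le) (auto simp: n_def)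
    with m have n: "inverse (real (Suc n)) < e"
      by linarith
    have "q x \<in> F n"
      by (simp add: F_def n_def)
    have "P \<subseteq> cone x e" if P: "P \<in> \<P> n" "x \<in> P" for P
    proof -
      obtain y c where y: "P = cone y c" "c < inverse (real (Suc n))" "q x \<le> q y \<or> q y + c \<le> q x"
        using P \<open>q x \<in> F n\<close> by (auto simp: \<P>_def)
      \<comment> \<open>Since \<open>x\<close> lies in the cone, its height is at least
        \<open>q y\<close> and below \<open>q y + c\<close>, which rules out the second alternative.
        So every cone in the star has its apex at \<open>x\<close>.\<close>
      then have "q x = q y"
        using P by (auto simp: cone_def)
      then have "x = y"
        using cone_level P y by blast
      then show ?thesis
        using y n cone_mono[of c e] by auto
    qed
    then show ?thesis
      using e by (fastforce simp: star_def)
  qed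
  have "development T \<P>"
    unfolding development_def nbhd_base_family_def
  proof (intro conjI allI ballI impI)
    show "openin T P" if "P \<in> \<P> n" for n P
      using that openin_cone by (auto simp: \<P>_def)
    show "N \<subseteq> topspace T" for N
      by simp
    show "\<exists>U. openin T U \<and> x \<in> U \<and> U \<subseteq> N" if "N \<in> range (\<lambda>n. star x (\<P> n))" for x N
      using that star_nbhd by auto
    show "\<exists>N\<in>range (\<lambda>n. star x (\<P> n)). N \<subseteq> W" if "openin T W \<and> x \<in> W" for x W
      using that star_small by auto
  qed
  then show ?thesis
    unfolding developable_space_def by blast
qed

section \<open>The group structure, transported from coordinatewise addition\<close>

definition pt :: "real \<Rightarrow> real \<Rightarrow> 'a" where
  "pt a b = (SOME x. p x = a \<and> q x = b)"

lemma pt [simp]: "b \<in> \<rat> \<Longrightarrow> p (pt a b) = a" "b \<in> \<rat> \<Longrightarrow> q (pt a b) = b"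
  using someI_ex[OF point_exists] by (auto simp: pt_def)

definition G :: "'a monoid" where
  "G = \<lparr>carrier = UNIV, mult = \<lambda>x y. pt (p x + p y) (q x + q y), one = pt 0 0\<rparr>"

lemma G_simps [simp]:
  "carrier G = UNIV" "p (x \<otimes>\<^bsub>G\<^esub> y) = p x + p y" "q (x \<otimes>\<^bsub>G\<^esub> y) = q x + q y"
  "p \<one>\<^bsub>G\<^esub> = 0" "q \<one>\<^bsub>G\<^esub> = 0"
  by (simp_all add: G_def)

lemma group_G: "group G"
proof (rule groupI)
  show "\<exists>y\<in>carrier G. y \<otimes>\<^bsub>G\<^esub> x = \<one>\<^bsub>G\<^esub>" for x
    by (rule bexI[of _ "pt (- p x) (- q x)"]) (auto intro: eqI)
qed (auto intro: eqI)

lemma continuous_mult: "continuous_map (prod_topology T T) T (\<lambda>(x, y). x \<otimes>\<^bsub>G\<^esub> y)"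
  unfolding continuous_map_def
proof (intro conjI allI impI)
  fix W
  assume W: "openin T W"
  show "openin (prod_topology T T) {z \<in> topspace (prod_topology T T). (case z of (x, y) \<Rightarrow> x \<otimes>\<^bsub>G\<^esub> y) \<in> W}"
    unfolding openin_prod_topology_alt
  proof (intro allI impI)
    fix x y
    assume "(x, y) \<in> {z \<in> topspace (prod_topology T T). (case z of (x, y) \<Rightarrow> x \<otimes>\<^bsub>G\<^esub> y) \<in> W}"
    then obtain e where e: "e > 0" "cone (x \<otimes>\<^bsub>G\<^esub> y) e \<subseteq> W"
      using W by (auto simp: openin_T)
    \<comment> \<open>Cone inequalities at \<open>x\<close> and at \<open>y\<close> add up to those
      at the product, and two half heights stay below \<open>e\<close>.\<close>
    have "x' \<otimes>\<^bsub>G\<^esub> y' \<in> cone (x \<otimes>\<^bsub>G\<^esub> y) e" if "x' \<in> cone x (e / 2)" "y' \<in> cone y (e / 2)" for x' y'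
      using that by (auto simp: cone_def)
    then show "\<exists>U V. openin T U \<and> openin T V \<and> x \<in> U \<and> y \<in> V \<and>
        U \<times> V \<subseteq> {z \<in> topspace (prod_topology T T). (case z of (x, y) \<Rightarrow> x \<otimes>\<^bsub>G\<^esub> y) \<in> W}"
      using e openin_cone apex_in_cone
      by (intro exI[of _ "cone x (e / 2)"] exI[of _ "cone y (e / 2)"]) auto
  qed
qed auto

lemma paratopological_group_G: "paratopological_group G T"
  unfolding paratopological_group_def using group_G continuous_mult by simp

end

theorem mainTheorem5:
  shows "\<exists>(G :: real monoid) (T :: real topology).
           paratopological_group G T \<and> t0_space T \<and>
           separable_space T \<and> Moore_space T \<and> \<not> metrizable_space T"
proof -
  obtain h :: "real \<Rightarrow> real \<times> real" where "bij_betw h UNIV (UNIV \<times> \<rat>)"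
    using real_bij_betw_real_times_rat by blast
  then interpret rational_plane "fst \<circ> h" "snd \<circ> h"
    by unfold_locales simp
  show ?thesis
    unfolding Moore_space_def
    by (intro exI[of _ G] exI[of _ T] conjI paratopological_group_G t0_T separable_T regular_T
        developable_T not_metrizable_T)
qed

end
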